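(* Let $n\geq 1$ be an integer and let $\zeta\in\mathbb{R}$ be a real number that is not algebraic of degree $\leq n$. Then \[ w_{n}^{\ast}(\zeta)\geq w_{n,n+1}(\zeta) \qquad\text{and}\qquad \widehat{w}_{n}^{\ast}(\zeta)\geq \widehat{w}_{n,n+1}(\zeta). \]
   Context: For an algebraic number $\alpha$, $H(\alpha)$ denotes the largest absolute value of the coefficients of its minimal polynomial over $\mathbb{Z}$ with relatively prime integer coefficients. $w_{n}^{\ast}(\zeta)$ is the supremum of all real $\nu$ such that $\vert\zeta-\alpha\vert\leq H(\alpha)^{-\nu-1}$ has infinitely many solutions $\alpha$ algebraic of degree $\leq n$. $\widehat{w}_{n}^{\ast}(\zeta)$ is the supremum of all real $\nu$ such that for every sufficiently large $H$ there exists an algebraic number $\alpha$ of degree $\leq n$ with $H(\alpha)\leq H$ and $\vert\zeta-\alpha\vert\leq H(\alpha)^{-1}H^{-\nu}$. For $1\leq j\leq n+1$, $w_{n,j}(\zeta)$ (resp. $\widehat{w}_{n,j}(\zeta)$) is the supremum of all real $\nu$ such that the system $\vert y_{i}\vert\leq X$ ($1\leq i\leq n$), $\vert x+\zeta y_{1}+\zeta^{2}y_{2}+\cdots+\zeta^{n}y_{n}\vert\leq X^{-\nu}$ has $j$ linearly independent integer solutions $(x,y_{1},\ldots,y_{n})\in\mathbb{Z}^{n+1}$ for arbitrarily large values of $X$ (resp. for all sufficiently large $X$). *)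

theory Defs
  imports "HOL-Analysis.Analysis" "HOL-Computational_Algebra.Polynomial" "HOL-Library.Extended_Real"
begin

text \<open>The minimal polynomial of a complex algebraic number over the integers:
  the irreducible integer polynomial (hence primitive, i.e. with coprime coefficients)
  with positive leading coefficient that vanishes at the number.\<close>
definition is_int_minpoly :: "complex \<Rightarrow> int poly \<Rightarrow> bool" where
  "is_int_minpoly \<alpha> p \<longleftrightarrow> irreducible p \<and> lead_coeff p > 0 \<and> poly (map_poly of_int p) \<alpha> = 0"

definition int_minpoly :: "complex \<Rightarrow> int poly" where
  "int_minpoly \<alpha> = (THE p. is_int_minpoly \<alpha> p)"

definition alg_deg_le :: "nat \<Rightarrow> complex \<Rightarrow> bool" where
  "alg_deg_le n \<alpha> \<longleftrightarrow> (\<exists>p. is_int_minpoly \<alpha> p) \<and> degree (int_minpoly \<alpha>) \<le> n"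

definition height :: "complex \<Rightarrow> real" where
  "height \<alpha> = real_of_int (Max ((\<lambda>i. \<bar>coeff (int_minpoly \<alpha>) i\<bar>) ` {..degree (int_minpoly \<alpha>)}))"

definition wstar :: "nat \<Rightarrow> real \<Rightarrow> ereal" where
  "wstar n \<zeta> = Sup (ereal ` {\<nu>. infinite {\<alpha>. alg_deg_le n \<alpha> \<and>
       cmod (complex_of_real \<zeta> - \<alpha>) \<le> height \<alpha> powr (- \<nu> - 1)}})"

definition wstar_hat :: "nat \<Rightarrow> real \<Rightarrow> ereal" where
  "wstar_hat n \<zeta> = Sup (ereal ` {\<nu>. \<forall>\<^sub>F H in at_top. \<exists>\<alpha>. alg_deg_le n \<alpha> \<and> height \<alpha> \<le> H \<and>
       cmod (complex_of_real \<zeta> - \<alpha>) \<le> (height \<alpha>) powr (-1) * H powr (- \<nu>)})"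

text \<open>Integer vectors (x, y_1, ..., y_n) are represented as functions v :: nat \<Rightarrow> int,
  with v 0 = x and v i = y_i for 1 \<le> i \<le> n (values at indices > n are irrelevant).
  A family of j such vectors v 0, ..., v (j-1) is linearly independent (over \<real>, equivalently over \<rat>).\<close>
definition lin_indep_int :: "nat \<Rightarrow> nat \<Rightarrow> (nat \<Rightarrow> nat \<Rightarrow> int) \<Rightarrow> bool" where
  "lin_indep_int n j v \<longleftrightarrow>
     (\<forall>c::nat \<Rightarrow> real. (\<forall>k\<le>n. (\<Sum>l<j. c l * real_of_int (v l k)) = 0) \<longrightarrow> (\<forall>l<j. c l = 0))"

definition good_system :: "nat \<Rightarrow> nat \<Rightarrow> real \<Rightarrow> real \<Rightarrow> real \<Rightarrow> bool" where
  "good_system n j \<zeta> \<nu> X \<longleftrightarrow> (\<exists>v. lin_indep_int n j v \<and>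
     (\<forall>l<j. (\<forall>i\<in>{1..n}. \<bar>real_of_int (v l i)\<bar> \<le> X) \<and>
        \<bar>real_of_int (v l 0) + (\<Sum>i=1..n. \<zeta> ^ i * real_of_int (v l i))\<bar> \<le> X powr (- \<nu>)))"

definition w_lin :: "nat \<Rightarrow> nat \<Rightarrow> real \<Rightarrow> ereal" where
  "w_lin n j \<zeta> = Sup (ereal ` {\<nu>. \<exists>\<^sub>F X in at_top. good_system n j \<zeta> \<nu> X})"

definition w_lin_hat :: "nat \<Rightarrow> nat \<Rightarrow> real \<Rightarrow> ereal" where
  "w_lin_hat n j \<zeta> = Sup (ereal ` {\<nu>. \<forall>\<^sub>F X in at_top. good_system n j \<zeta> \<nu> X})"

end

theory Submission
  imports "Berlekamp_Zassenhaus.Factor_Bound" "HOL-Real_Asymp.Real_Asymp" Defs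
begin

text \<open>
  Given \<open>n + 1\<close> linearly independent integer polynomials \<open>P\<^sub>l\<close> of size \<open>O(X)\<close> with
  \<open>\<bar>P\<^sub>l(\<zeta>)\<bar> \<le> X\<^bsup>-\<nu>\<^esup>\<close>, write the real polynomial \<open>K X (x - \<zeta>)\<close> as \<open>\<Sum> c\<^sub>l P\<^sub>l\<close> and round the
  coefficients to integers: \<open>P = \<Sum> \<lfloor>c\<^sub>l\<rfloor> P\<^sub>l\<close>. Then \<open>P\<close> has height \<open>O(X)\<close>, \<open>P(\<zeta>) = O(X\<^bsup>-\<nu>\<^esup>)\<close>,
  and for a large constant \<open>K\<close> its slope near \<open>\<zeta>\<close> is at least \<open>X\<close>, so \<open>P\<close> has a real root \<open>\<alpha>\<close>
  with \<open>\<bar>\<zeta> - \<alpha>\<bar> = O(X\<^bsup>-\<nu>-1\<^esup>)\<close>. By multiplicativity of the Mahler measure the minimal polynomial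
  of \<open>\<alpha>\<close>, a factor of \<open>P\<close>, also has height \<open>O(X)\<close>.
\<close>

no_notation Finite_Cartesian_Product.vec_nth (infixl "$" 90)

section \<open>Coefficients of factors of integer polynomials\<close>

text \<open>Mignotte's bound controls the coefficients of \<open>g\<close> by its Mahler measure.
  This is at most that of \<open>f\<close>, because the cofactor is a nonzero integer polynomial and
  has measure at least 1. Landau's inequality then bounds the measure of \<open>f\<close> by the
  Euclidean norm of its coefficients.\<close>

lemma int_poly_factor_coeff_bound:
  fixes f g :: "int poly"
  assumes f0: "f \<noteq> 0" and dvd: "g dvd f" and deg: "degree f \<le> n"
    and coeff: "\<And>i. real_of_int \<bar>coeff f i\<bar> \<le> M"
  shows "real_of_int \<bar>coeff g k\<bar> \<le> 2 ^ n * (real n + 1) * M"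
proof -
  let ?F = "of_int_poly f :: complex poly"
  have M0: "M \<ge> 0" using coeff[of 0] by simp
  have gf: "degree g \<le> n" using dvd_imp_degree_le[OF dvd f0] deg by simp
  have "(\<Sum>a\<leftarrow>coeffs ?F. (cmod a)\<^sup>2) = (\<Sum>i\<le>degree f. (cmod (coeff ?F i))\<^sup>2)"
    using f0 by (simp add: coeffs_def sum_list_sum_nth atLeast0AtMost atLeast0LessThan flip: lessThan_Suc_atMost del: upt_Suc)
  also have "\<dots> \<le> (\<Sum>i\<le>degree f. M\<^sup>2)"
  proof (intro sum_mono power_mono)
    fix i show "cmod (coeff ?F i) \<le> M" using coeff[of i] by simp
  qed auto
  also have "\<dots> = (real (degree f) + 1) * M\<^sup>2" by simp
  \<comment> \<open>Squaring \<open>real n + 1\<close> is wasteful, but it keeps a square root out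
    of the final constant.\<close>
  also have "\<dots> \<le> (real n + 1)^2 * M\<^sup>2"
  proof (rule mult_right_mono)
    have "real (degree f) + 1 \<le> (real n + 1) * 1" using deg by simp
    also have "\<dots> \<le> (real n + 1) * (real n + 1)" by (intro mult_left_mono) auto
    finally show "real (degree f) + 1 \<le> (real n + 1)^2" by (simp add: power2_eq_square)
  qed simp
  finally have "sqrt (\<Sum>a\<leftarrow>coeffs ?F. (cmod a)\<^sup>2) \<le> (real n + 1) * M"
    using M0 by (intro real_le_lsqrt) (auto simp: power_mult_distrib)
  with Landau_inequality[of ?F] have mf: "mahler_measure f \<le> (real n + 1) * M"
    unfolding mahler_measure_def by linarith
  have "real_of_int \<bar>coeff g k\<bar> \<le> real (degree g choose k) * mahler_measure g"
    by (rule Mignotte_bound)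
  also have "\<dots> \<le> 2 ^ n * mahler_measure f"
  proof (rule mult_mono)
    have "degree g choose k \<le> 2 ^ degree g" by (rule binomial_le_pow2)
    also have "\<dots> \<le> 2 ^ n" using gf by (intro power_increasing) auto
    finally have "degree g choose k \<le> 2 ^ n" .
    from of_nat_mono[OF this, where 'a = real] show "real (degree g choose k) \<le> 2 ^ n"
      by simp
  qed (auto simp: mahler_measure_ge_0 mahler_measure_dvd[OF f0 dvd])
  also have "\<dots> \<le> 2 ^ n * ((real n + 1) * M)" using mf by (intro mult_left_mono) auto
  finally show ?thesis by (simp add: mult.assoc)
qed

section \<open>Solving linear systems over the reals\<close>

text \<open>The square matrix with the vectors as columns has trivial kernel, hence nonzero
  determinant, so every right-hand side \<open>r\<close> is attained.\<close>

lemma lin_indep_int_spanning: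
  assumes "lin_indep_int n (n + 1) v"
  obtains c :: "nat \<Rightarrow> real" where "\<And>k. k \<le> n \<Longrightarrow> (\<Sum>l\<le>n. c l * real_of_int (v l k)) = r k"
proof -
  define A where "A = Matrix.mat (n+1) (n+1) (\<lambda>(k,l). real_of_int (v l k))"
  have A: "A \<in> carrier_mat (n+1) (n+1)" by (simp add: A_def)
  have mv: "(A *\<^sub>v u) $ k = (\<Sum>l\<le>n. u $ l * real_of_int (v l k))"
    if "u \<in> carrier_vec (n+1)" "k \<le> n" for u k
    using that by (simp add: A_def scalar_prod_def atLeast0LessThan lessThan_Suc_atMost mult.commute del: sum.lessThan_Suc)
  have "Determinant.det A \<noteq> 0"
  proof
    assume "Determinant.det A = 0"
    then obtain u where u: "u \<in> carrier_vec (n+1)" "u \<noteq> 0\<^sub>v (n+1)" "A *\<^sub>v u = 0\<^sub>v (n+1)"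
      using det_0_iff_vec_prod_zero_field[OF A] by blast
    have "\<forall>k\<le>n. (\<Sum>l<n+1. u $ l * real_of_int (v l k)) = 0"
      using mv[OF u(1)] u(3) by (auto simp: lessThan_Suc_atMost)
    with assms have "\<forall>l<n+1. u $ l = 0" unfolding lin_indep_int_def by blast
    with u(1,2) show False by auto
  qed
  \<comment> \<open>Cramer's rule: the adjugate divided by the determinant inverts
    \<open>A\<close>.\<close>
  define u where "u = (1 / Determinant.det A) \<cdot>\<^sub>v (adj_mat A *\<^sub>v Matrix.vec (n+1) r)"
  have adj: "adj_mat A \<in> carrier_mat (n+1) (n+1)" and AA: "A * adj_mat A = Determinant.det A \<cdot>\<^sub>m 1\<^sub>m (n+1)"
    using adj_mat[OF A] by auto
  have u: "u \<in> carrier_vec (n+1)" using adj by (simp add: u_def)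
  have "A *\<^sub>v u = (1 / Determinant.det A) \<cdot>\<^sub>v ((A * adj_mat A) *\<^sub>v Matrix.vec (n+1) r)"
    unfolding u_def using A adj by (simp add: mult_mat_vec assoc_mult_mat_vec[OF A adj])
  also have "\<dots> = Matrix.vec (n+1) r"
    unfolding AA using \<open>Determinant.det A \<noteq> 0\<close>
    by (intro eq_vecI) (auto simp: smult_scalar_prod_distrib row_smult)
  finally have "A *\<^sub>v u = Matrix.vec (n+1) r" .
  with mv[OF u] have "(\<Sum>l\<le>n. u $ l * real_of_int (v l k)) = r k" if "k \<le> n" for k
    using that by (metis index_vec less_Suc_eq_le Suc_eq_plus1)
  thus ?thesis by (rule that)
qed

section \<open>Minimal polynomials and heights over the integers\<close>

text \<open>Pseudo-division by a polynomial \<open>m\<close> of minimal degree vanishing at \<open>\<alpha>\<close> replaces the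
  passage to rational coefficients.\<close>
lemma irreducible_root_dvd:
  fixes p f :: "int poly" and \<alpha> :: complex
  assumes p: "irreducible p" "poly (of_int_poly p) \<alpha> = 0" and f: "poly (of_int_poly f) \<alpha> = 0"
  shows "p dvd f"
proof -
  have p0: "p \<noteq> 0" using p(1) by auto
  have nonconst: "degree g > 0" if "g \<noteq> 0" "poly (of_int_poly g) \<alpha> = 0" for g :: "int poly"
  proof (rule ccontr)
    assume "\<not> degree g > 0"
    then obtain a where "g = [:a:]" by (metis degree_eq_zeroE gr0I)
    with that show False by auto
  qed
  obtain m :: "int poly" where m: "m \<noteq> 0" "poly (of_int_poly m) \<alpha> = 0"
    and m_min: "\<And>g. g \<noteq> 0 \<Longrightarrow> poly (of_int_poly g) \<alpha> = 0 \<Longrightarrow> degree m \<le> degree g"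
    using ex_has_least_nat[of "\<lambda>g. g \<noteq> 0 \<and> poly (of_int_poly g) \<alpha> = 0" p degree] p p0 by blast
  have m_dvd: "\<exists>a q. a \<noteq> 0 \<and> smult a g = m * q" if g: "poly (of_int_poly g) \<alpha> = 0" for g :: "int poly"
  proof -
    obtain a q where aq: "a \<noteq> 0" "smult a g = m * q + pseudo_mod g m"
      using pseudo_mod(1)[OF m(1), of g] by auto
    have "of_int_poly (pseudo_mod g m) = (of_int_poly (smult a g) - of_int_poly (m * q) :: complex poly)"
      unfolding aq(2) by (simp add: of_int_poly_hom.hom_add)
    hence "poly (of_int_poly (pseudo_mod g m)) \<alpha> = 0"
      using g m(2) by (simp add: of_int_poly_hom.hom_mult of_int_hom.map_poly_hom_smult)
    moreover have "pseudo_mod g m = 0 \<or> degree (pseudo_mod g m) < degree m"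
      using pseudo_mod(2)[OF m(1), of g] by auto
    ultimately have "pseudo_mod g m = 0" using m_min by force
    with aq show ?thesis by auto
  qed
  have prime: "prime_elem p" using p(1) by (rule irreducible_imp_prime_elem)
  obtain a q where aq: "a \<noteq> 0" "smult a p = m * q" using m_dvd[OF p(2)] by blast
  \<comment> \<open>Otherwise cancelling \<open>p\<close> would make \<open>m\<close> divide the
    nonzero constant \<open>a\<close>, although \<open>m\<close> has a root and so positive
    degree.\<close>
  have "\<not> p dvd q"
  proof
    assume "p dvd q"
    then obtain h where "q = p * h" by (elim dvdE)
    with aq(2) have "p * [:a:] = p * (m * h)" by (simp add: mult_ac)
    hence ma: "[:a:] = m * h" using p0 mult_left_cancel by blast
    with aq(1) have "h \<noteq> 0" by auto
    with ma m(1) have "degree m = 0" by (metis degree_mult_eq degree_pCons_0 add_is_0)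
    with nonconst[OF m] show False by simp
  qed
  moreover have "p dvd m * q" using aq(2) by (metis dvd_smult dvd_refl)
  ultimately have pm: "p dvd m" by (auto dest: prime_elem_dvd_multD[OF prime])
  obtain b r where br: "b \<noteq> 0" "smult b f = m * r" using m_dvd[OF f] by blast
  have "p dvd [:b:] * f" using pm br(2) by (simp add: dvd_mult2)
  moreover have "\<not> p dvd [:b:]"
  proof
    assume "p dvd [:b:]"
    from dvd_imp_degree_le[OF this] br(1) have "degree p = 0" by simp
    with nonconst[OF p0 p(2)] show False by simp
  qed
  ultimately show ?thesis using prime_elem_dvd_multD[OF prime] by blast
qed

text \<open>Two candidates divide each other, so they differ by a unit, and the sign of the leading
  coefficient makes this unit 1. This justifies the definite description in
  \<open>int_minpoly\<close>.\<close>

lemma int_minpoly_eqI: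
  assumes "is_int_minpoly \<alpha> p"
  shows "int_minpoly \<alpha> = p"
  unfolding int_minpoly_def
proof (rule the_equality[of "is_int_minpoly \<alpha>", OF assms])
  fix q assume q: "is_int_minpoly \<alpha> q"
  have dvd: "p dvd q" "q dvd p"
    using assms q by (auto simp: is_int_minpoly_def intro: irreducible_root_dvd)
  then obtain c where c: "q = p * c" by (elim dvdE)
  have q0: "q \<noteq> 0" using q by (auto simp: is_int_minpoly_def)
  have "c dvd 1" using dvd(2) q0 unfolding c by auto
  then obtain u where u: "c = [:u:]" "u dvd 1" by (auto simp: is_unit_poly_iff)
  moreover have "lead_coeff p > 0" "lead_coeff q > 0"
    using assms q by (auto simp: is_int_minpoly_def)
  ultimately have "u = 1" unfolding c by (auto simp: lead_coeff_mult zero_less_mult_iff)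
  with c u show "q = p" by simp
qed

text \<open>Some prime factor of \<open>f\<close> vanishes at \<alpha>; up to sign it is the minimal
  polynomial.\<close>

lemma int_minpoly_dvd_exists:
  fixes f :: "int poly"
  assumes "f \<noteq> 0" "poly (of_int_poly f) \<alpha> = 0"
  shows "\<exists>p. is_int_minpoly \<alpha> p \<and> p dvd f"
  using assms
proof (induction f rule: prime_divisors_induct)
  case (unit u)
  then obtain a where "u = [:a:]" by (auto simp: is_unit_poly_iff)
  with unit show ?case by auto
next
  case (factor p g)
  show ?case
  proof (cases "poly (of_int_poly p) \<alpha> = 0")
    case True
    have "irreducible p" using factor(1) by (auto intro: prime_elem_imp_irreducible)
    moreover have "p \<noteq> 0" using factor(1) by auto
    ultimately have "is_int_minpoly \<alpha> p \<or> is_int_minpoly \<alpha> (- p)"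
      using True by (auto simp: is_int_minpoly_def not_less of_int_poly_hom.hom_uminus
          le_less leading_coeff_0_iff)
    thus ?thesis by (metis dvd_triv_left minus_dvd_iff)
  next
    \<comment> \<open>Constant primes dividing the content of the polynomial also fall under this
      case, since they have no root.\<close>
    case False
    with factor(4) have "poly (of_int_poly g) \<alpha> = 0" by (simp add: of_int_poly_hom.hom_mult)
    with factor obtain q where "is_int_minpoly \<alpha> q" "q dvd g" by auto
    thus ?thesis by (auto intro: dvd_mult)
  qed
qed auto

text \<open>The minimal polynomial is a factor of \<open>f\<close>, so the coefficient bound for
  factors applies. The lower bound 1 comes from its positive integer leading coefficient; it makes
  powers of the height with negative exponent monotone later.\<close>

lemma height_root_le:
  fixes f :: "int poly"
  assumes f0: "f \<noteq> 0" and root: "poly (of_int_poly f) \<alpha> = 0" and deg: "degree f \<le> n"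
    and coeff: "\<And>i. real_of_int \<bar>coeff f i\<bar> \<le> M"
  shows "alg_deg_le n \<alpha>" "1 \<le> Defs.height \<alpha>" "Defs.height \<alpha> \<le> 2 ^ n * (real n + 1) * M"
proof -
  obtain p where p: "is_int_minpoly \<alpha> p" "p dvd f"
    using int_minpoly_dvd_exists[OF f0 root] by blast
  have eq: "int_minpoly \<alpha> = p" by (rule int_minpoly_eqI[OF p(1)])
  show "alg_deg_le n \<alpha>"
    using p dvd_imp_degree_le[OF p(2) f0] deg by (auto simp: alg_deg_le_def eq)
  let ?S = "(\<lambda>i. \<bar>coeff p i\<bar>) ` {..degree p}"
  have "Max ?S \<in> ?S" by (rule Max_in) auto
  then obtain k where "k \<le> degree p" "Max ?S = \<bar>coeff p k\<bar>" by (elim imageE) simp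
  with int_poly_factor_coeff_bound[OF f0 p(2) deg coeff, of k]
  show "Defs.height \<alpha> \<le> 2 ^ n * (real n + 1) * M" by (simp add: height_def eq)
  have "\<bar>lead_coeff p\<bar> \<le> Max ?S" by (rule Max_ge) auto
  moreover have "lead_coeff p > 0" using p(1) by (simp add: is_int_minpoly_def)
  ultimately show "1 \<le> Defs.height \<alpha>" by (simp add: height_def eq)
qed

section \<open>Locating a real root near \<zeta>\<close>

lemma abs_power_diff_le:
  fixes z w Z :: real
  assumes "\<bar>z\<bar> \<le> Z" "\<bar>w\<bar> \<le> Z" "1 \<le> Z"
  shows "\<bar>z ^ k - w ^ k\<bar> \<le> real k * Z ^ k * \<bar>z - w\<bar>"
proof (induction k)
  case (Suc k)
  have "z ^ Suc k - w ^ Suc k = z * (z ^ k - w ^ k) + w ^ k * (z - w)"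
    by (simp add: algebra_simps)
  also have "\<bar>\<dots>\<bar> \<le> \<bar>z\<bar> * \<bar>z ^ k - w ^ k\<bar> + \<bar>w\<bar> ^ k * \<bar>z - w\<bar>"
    by (metis abs_mult abs_triangle_ineq power_abs)
  also have "\<dots> \<le> Z * (real k * Z ^ k * \<bar>z - w\<bar>) + Z ^ Suc k * \<bar>z - w\<bar>"
  proof (intro add_mono mult_mono)
    have "\<bar>w\<bar> ^ k \<le> Z ^ k" using assms by (intro power_mono) auto
    also have "\<dots> \<le> Z ^ Suc k" using assms by (intro power_increasing) auto
    finally show "\<bar>w\<bar> ^ k \<le> Z ^ Suc k" .
  qed (use assms Suc in auto)
  also have "\<dots> = real (Suc k) * Z ^ Suc k * \<bar>z - w\<bar>" by (simp add: algebra_simps)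
  finally show ?case .
qed simp


text \<open>For \<open>z\<close> within distance 1 of \<zeta>, the sum with coefficients
  \<open>e k\<close> differs from its value at \<zeta> by at most
  \<open>(K - 1) * X * \<bar>z - \<zeta>\<bar>\<close>. The linear term of \<open>F\<close> beats
  this with slope \<open>X\<close> to spare, which is the summand 1 in \<open>K\<close>. Hence
  \<open>F\<close> has opposite weak signs at distance \<delta> on the two sides of \<zeta>. The
  second conclusion later shows that an integer polynomial is nonzero.\<close>

lemma root_near_of_large_slope:
  fixes e :: "nat \<Rightarrow> real"
  assumes n: "n \<ge> 1" and X: "X > 0" and Z: "\<bar>\<zeta>\<bar> + 1 \<le> Z"
    and e: "\<And>k. k \<le> n \<Longrightarrow> \<bar>e k\<bar> \<le> D * X"
    and K: "K = real (n + 1) * D * real n * Z ^ n + 1"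
    and F: "\<And>z. F z = (\<Sum>k\<le>n. e k * z ^ k) + K * X * (z - \<zeta>)"
    and small: "\<bar>\<Sum>k\<le>n. e k * \<zeta> ^ k\<bar> \<le> \<delta> * X" and \<delta>: "0 \<le> \<delta>" "\<delta> \<le> 1"
  shows "\<exists>x. \<bar>\<zeta> - x\<bar> \<le> \<delta> \<and> F x = 0" "F (\<zeta> + 1) \<noteq> F \<zeta>"
proof -
  define E where "E z = (\<Sum>k\<le>n. e k * z ^ k)" for z
  have D: "0 \<le> D * X" using e[of 0] by simp
  have Z1: "Z \<ge> 1" using Z by linarith
  have lip: "\<bar>E z - E \<zeta>\<bar> \<le> (K - 1) * X * \<bar>z - \<zeta>\<bar>" if z: "\<bar>z - \<zeta>\<bar> \<le> 1" for z
  proof -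
    have "\<bar>E z - E \<zeta>\<bar> = \<bar>\<Sum>k\<le>n. e k * (z ^ k - \<zeta> ^ k)\<bar>"
      by (simp add: E_def right_diff_distrib sum_subtractf)
    also have "\<dots> \<le> (\<Sum>k\<le>n. \<bar>e k * (z ^ k - \<zeta> ^ k)\<bar>)" by (rule sum_abs)
    also have "\<dots> \<le> (\<Sum>k\<le>n. D * X * (real n * Z ^ n * \<bar>z - \<zeta>\<bar>))"
    proof (rule sum_mono)
      fix k assume k: "k \<in> {..n}"
      have "\<bar>z ^ k - \<zeta> ^ k\<bar> \<le> real k * Z ^ k * \<bar>z - \<zeta>\<bar>"
        using z Z Z1 by (intro abs_power_diff_le) linarith+
      also have "\<dots> \<le> real n * Z ^ n * \<bar>z - \<zeta>\<bar>"
        using k Z1 by (intro mult_right_mono mult_mono power_increasing) auto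
      finally show "\<bar>e k * (z ^ k - \<zeta> ^ k)\<bar> \<le> D * X * (real n * Z ^ n * \<bar>z - \<zeta>\<bar>)"
        unfolding abs_mult using e[of k] k D by (intro mult_mono) auto
    qed
    also have "\<dots> = (K - 1) * X * \<bar>z - \<zeta>\<bar>" by (simp add: K algebra_simps)
    finally show ?thesis .
  qed
  have FE: "F z = E z + K * X * (z - \<zeta>)" for z by (simp add: F E_def)
  have up: "F (\<zeta> + d) \<ge> E \<zeta> + X * d" if "0 \<le> d" "d \<le> 1" for d
    using lip[of "\<zeta> + d"] that by (simp add: FE algebra_simps abs_le_iff)
  have down: "F (\<zeta> - d) \<le> E \<zeta> - X * d" if "0 \<le> d" "d \<le> 1" for d
    using lip[of "\<zeta> - d"] that by (simp add: FE algebra_simps abs_le_iff)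
  have "F (\<zeta> - \<delta>) \<le> 0" "0 \<le> F (\<zeta> + \<delta>)"
    using up[OF \<delta>] down[OF \<delta>] small unfolding E_def[symmetric] by (simp_all add: abs_le_iff mult.commute)
  moreover have "continuous_on {\<zeta> - \<delta>..\<zeta> + \<delta>} F"
    unfolding F by (intro continuous_intros)
  ultimately obtain x where "\<zeta> - \<delta> \<le> x" "x \<le> \<zeta> + \<delta>" "F x = 0"
    using IVT'[of F "\<zeta> - \<delta>" 0 "\<zeta> + \<delta>"] \<delta> by auto
  thus "\<exists>x. \<bar>\<zeta> - x\<bar> \<le> \<delta> \<and> F x = 0" by (intro exI[of _ x]) auto
  show "F (\<zeta> + 1) \<noteq> F \<zeta>" using up[of 1] X by (simp add: FE[of \<zeta>])
qed

section \<open>From independent integer solutions to an algebraic approximation\<close>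

text \<open>The hypothesis \<open>(n + 1) X\<^bsup>-\<nu>\<^esup> \<le> X\<close> keeps the root within distance 1 of \<open>\<zeta>\<close>.\<close>
lemma good_system_imp_approximation:
  fixes \<zeta> :: real
  assumes n: "n \<ge> 1"
  shows "\<exists>C\<ge>1. \<forall>\<nu> X. X \<ge> 1 \<and> real (n + 1) * X powr (- \<nu>) \<le> X \<and> good_system n (n + 1) \<zeta> \<nu> X \<longrightarrow>
    (\<exists>\<alpha>. alg_deg_le n \<alpha> \<and> 1 \<le> Defs.height \<alpha> \<and> Defs.height \<alpha> \<le> C * X \<and>
      cmod (complex_of_real \<zeta> - \<alpha>) \<le> C * X powr (- \<nu> - 1))"
proof -
  \<comment> \<open>The constants depend only on \<open>n\<close> and \<zeta>. \<open>Z\<close>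
    bounds the points within distance 1 of \<zeta>, \<open>D * X\<close> the coefficients of the
    rounding error, and \<open>(D + K * Z) * X\<close> those of the rounded polynomial.
    \<open>C\<close> covers both the height and the distance to the root.\<close>
  define Z where "Z = \<bar>\<zeta>\<bar> + 1"
  define D where "D = real (n + 1) * (1 + real n * Z ^ n)"
  define K where "K = real (n + 1) * D * real n * Z ^ n + 1"
  define C where "C = max (2 ^ n * (real n + 1) * (D + K * Z)) (real (n + 1))"
  have Z1: "Z \<ge> 1" by (simp add: Z_def)
  have D0: "D \<ge> 0" using Z1 by (simp add: D_def)
  have K1: "K \<ge> 1" using Z1 D0 by (simp add: K_def)
  have "\<exists>\<alpha>. alg_deg_le n \<alpha> \<and> 1 \<le> Defs.height \<alpha> \<and> Defs.height \<alpha> \<le> C * X \<and>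
      cmod (complex_of_real \<zeta> - \<alpha>) \<le> C * X powr (- \<nu> - 1)"
    if X: "X \<ge> 1" and small: "real (n + 1) * X powr (- \<nu>) \<le> X"
      and good: "good_system n (n + 1) \<zeta> \<nu> X" for \<nu> X
  proof -
    obtain v where ind: "lin_indep_int n (n + 1) v"
      and v: "\<And>l i. l \<le> n \<Longrightarrow> i \<in> {1..n} \<Longrightarrow> \<bar>real_of_int (v l i)\<bar> \<le> X"
      and v\<zeta>: "\<And>l. l \<le> n \<Longrightarrow> \<bar>real_of_int (v l 0) + (\<Sum>i=1..n. \<zeta> ^ i * real_of_int (v l i))\<bar> \<le> X powr (- \<nu>)"
      using good unfolding good_system_def by (auto simp: less_Suc_eq_le)
    have split0: "(\<Sum>k\<le>n. g k) = g 0 + (\<Sum>k=1..n. g k)" for g :: "nat \<Rightarrow> real"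
      by (metis One_nat_def atMost_atLeast0 le0 sum.atLeast_Suc_atMost)
    have Xnu: "X powr (- \<nu>) \<le> X"
    proof -
      have "1 * X powr (- \<nu>) \<le> real (n + 1) * X powr (- \<nu>)" by (intro mult_right_mono) auto
      with small show ?thesis by simp
    qed
    \<comment> \<open>The system does not bound the constant coefficient directly; it is recovered
      from the value at \<zeta>, which is at most \<open>X\<close> by \<open>Xnu\<close>.\<close>
    have vbound: "\<bar>real_of_int (v l k)\<bar> \<le> (1 + real n * Z ^ n) * X" if l: "l \<le> n" and k: "k \<le> n" for l k
    proof (cases "k = 0")
      case False
      with v[OF l, of k] k have "\<bar>real_of_int (v l k)\<bar> \<le> 1 * X" by auto
      also have "\<dots> \<le> (1 + real n * Z ^ n) * X" using X Z1 by (intro mult_right_mono) auto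
      finally show ?thesis .
    next
      case True
      have "\<bar>\<Sum>i=1..n. \<zeta> ^ i * real_of_int (v l i)\<bar> \<le> (\<Sum>i=1..n. \<bar>\<zeta> ^ i * real_of_int (v l i)\<bar>)"
        by (rule sum_abs)
      also have "\<dots> \<le> (\<Sum>i=1..n. Z ^ n * X)"
      proof (rule sum_mono)
        fix i assume i: "i \<in> {1..n}"
        have "\<bar>\<zeta>\<bar> ^ i \<le> Z ^ i" by (intro power_mono) (auto simp: Z_def)
        also have "\<dots> \<le> Z ^ n" using i Z1 by (intro power_increasing) auto
        finally show "\<bar>\<zeta> ^ i * real_of_int (v l i)\<bar> \<le> Z ^ n * X"
          unfolding abs_mult power_abs using v[OF l i] Z1 by (intro mult_mono) auto
      qed
      also have "\<dots> = real n * Z ^ n * X" by simp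
      finally show ?thesis using v\<zeta>[OF l] Xnu True by (simp add: algebra_simps abs_le_iff)
    qed
    \<comment> \<open>The coefficients of \<open>K * X * (z - \<zeta>)\<close> as a polynomial in
      \<open>z\<close>.\<close>
    define r where "r k = (if k = 0 then - K * X * \<zeta> else if k = 1 then K * X else 0)" for k :: nat
    obtain c where c: "\<And>k. k \<le> n \<Longrightarrow> (\<Sum>l\<le>n. c l * real_of_int (v l k)) = r k"
      using lin_indep_int_spanning[OF ind] by blast
    define t where "t l = \<lfloor>c l\<rfloor>" for l
    define P where "P = (\<Sum>k\<le>n. monom (\<Sum>l\<le>n. t l * v l k) k)"
    \<comment> \<open>The coefficients of the rounding error, that is, of \<open>P\<close> minus the
      real target polynomial.\<close>
    define e where "e k = (\<Sum>l\<le>n. (real_of_int (t l) - c l) * real_of_int (v l k))" for k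
    define F where "F z = (\<Sum>k\<le>n. e k * z ^ k) + K * X * (z - \<zeta>)" for z
    have tc: "\<bar>real_of_int (t l) - c l\<bar> \<le> 1" for l unfolding t_def by linarith
    have coeffP: "coeff P k = (if k \<le> n then \<Sum>l\<le>n. t l * v l k else 0)" for k
      by (simp add: P_def coeff_sum)
    have degP: "degree P \<le> n" by (rule degree_le) (simp add: coeffP)
    have coeffP_e: "real_of_int (coeff P k) = e k + r k" if "k \<le> n" for k
      using that by (simp add: coeffP e_def left_diff_distrib sum_subtractf c)
    have ebound: "\<bar>e k\<bar> \<le> D * X" if k: "k \<le> n" for k
    proof -
      have "\<bar>e k\<bar> \<le> (\<Sum>l\<le>n. \<bar>(real_of_int (t l) - c l) * real_of_int (v l k)\<bar>)"
        unfolding e_def by (rule sum_abs)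
      also have "\<dots> \<le> (\<Sum>l\<le>n. 1 * ((1 + real n * Z ^ n) * X))"
        unfolding abs_mult using tc vbound k by (intro sum_mono mult_mono) auto
      also have "\<dots> = D * X" by (simp add: D_def)
      finally show ?thesis .
    qed
    \<comment> \<open>At \<zeta> the error is a combination of the \<open>n + 1\<close> small values
      of the given polynomials, with weights of absolute value at most 1.\<close>
    have "\<bar>\<Sum>k\<le>n. e k * \<zeta> ^ k\<bar> \<le> real (n + 1) * X powr (- \<nu>)"
    proof -
      have "(\<Sum>k\<le>n. e k * \<zeta> ^ k) = (\<Sum>k\<le>n. \<Sum>l\<le>n. (real_of_int (t l) - c l) * (\<zeta> ^ k * real_of_int (v l k)))"
        by (simp add: e_def sum_distrib_left sum_distrib_right mult_ac)
      also have "\<dots> = (\<Sum>l\<le>n. (real_of_int (t l) - c l) * (\<Sum>k\<le>n. \<zeta> ^ k * real_of_int (v l k)))"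
        by (subst sum.swap) (simp add: sum_distrib_left)
      also have "\<bar>\<dots>\<bar> \<le> (\<Sum>l\<le>n. \<bar>(real_of_int (t l) - c l) * (\<Sum>k\<le>n. \<zeta> ^ k * real_of_int (v l k))\<bar>)"
        by (rule sum_abs)
      also have "\<dots> \<le> (\<Sum>l\<le>n. 1 * X powr (- \<nu>))"
        unfolding abs_mult using tc v\<zeta> by (intro sum_mono mult_mono) (auto simp: split0)
      finally show ?thesis by simp
    qed
    also have X\<delta>: "real (n + 1) * X powr (- \<nu>) = real (n + 1) * X powr (- \<nu> - 1) * X"
      using X by (simp add: powr_diff)
    finally have small_e: "\<bar>\<Sum>k\<le>n. e k * \<zeta> ^ k\<bar> \<le> real (n + 1) * X powr (- \<nu> - 1) * X" .
    have \<delta>1: "real (n + 1) * X powr (- \<nu> - 1) \<le> 1"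
      using small X unfolding X\<delta> by (simp add: mult_le_cancel_right1)
    have polyP: "poly (of_int_poly P) z = F z" for z :: real
    proof -
      have "poly (of_int_poly P) z = (\<Sum>k\<le>n. real_of_int (coeff P k) * z ^ k)"
        unfolding poly_altdef using degP
        by (intro sum.mono_neutral_cong_left) (auto simp: coeff_eq_0)
      also have "\<dots> = (\<Sum>k\<le>n. e k * z ^ k) + (\<Sum>k\<le>n. r k * z ^ k)"
        by (simp add: coeffP_e distrib_right sum.distrib)
      also have "(\<Sum>k\<le>n. r k * z ^ k) = (\<Sum>k\<in>{0,1}. r k * z ^ k)"
        using n by (intro sum.mono_neutral_right) (auto simp: r_def)
      finally show ?thesis by (simp add: r_def F_def algebra_simps)
    qed
    have Zz: "\<bar>\<zeta>\<bar> + 1 \<le> Z" by (simp add: Z_def)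
    have X0: "X > 0" using X by simp
    note root = root_near_of_large_slope[where e = e and F = F and X = X and D = D and Z = Z and K = K
        and \<zeta> = \<zeta> and n = n and \<delta> = "real (n + 1) * X powr (- \<nu> - 1)"]
    have "\<exists>x. \<bar>\<zeta> - x\<bar> \<le> real (n + 1) * X powr (- \<nu> - 1) \<and> F x = 0"
      by (rule root(1)) (use n X0 Zz ebound K_def F_def small_e \<delta>1 in auto)
    then obtain x where x: "\<bar>\<zeta> - x\<bar> \<le> real (n + 1) * X powr (- \<nu> - 1)" "F x = 0"
      by blast
    have F_neq: "F (\<zeta> + 1) \<noteq> F \<zeta>"
      by (rule root(2)) (use n X0 Zz ebound K_def F_def small_e \<delta>1 in auto)
    \<comment> \<open>\<open>P\<close> agrees with \<open>F\<close> on the reals, and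
      \<open>F\<close> takes different values at \<zeta> and \<open>\<zeta> + 1\<close>.\<close>
    have P0: "P \<noteq> 0"
    proof
      assume "P = 0"
      hence "F z = 0" for z using polyP[of z] by simp
      with F_neq show False by simp
    qed
    have Pbound: "real_of_int \<bar>coeff P k\<bar> \<le> (D + K * Z) * X" for k
    proof (cases "k \<le> n")
      case True
      have "\<bar>r k\<bar> \<le> K * Z * X"
        using K1 X Z1 by (auto simp: r_def abs_mult Z_def)
      with ebound[OF True] have "\<bar>e k + r k\<bar> \<le> D * X + K * Z * X" by linarith
      thus ?thesis using True by (simp add: coeffP_e algebra_simps)
    qed (use D0 K1 Z1 X in \<open>simp add: coeffP\<close>)
    have rootP: "poly (of_int_poly P) (complex_of_real x) = 0"
    proof -
      have "poly (of_int_poly P) (complex_of_real x) = complex_of_real (poly (of_int_poly P) x)"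
        by (simp add: poly_altdef)
      thus ?thesis using polyP[of x] x(2) by simp
    qed
    note H = height_root_le[OF P0 rootP degP Pbound]
    have "Defs.height x \<le> C * X"
    proof -
      have "Defs.height x \<le> 2 ^ n * (real n + 1) * (D + K * Z) * X"
        using H(3) by (simp add: mult_ac)
      also have "\<dots> \<le> C * X" using X by (intro mult_right_mono) (auto simp: C_def)
      finally show ?thesis .
    qed
    moreover have "cmod (complex_of_real \<zeta> - x) \<le> C * X powr (- \<nu> - 1)"
    proof -
      have "cmod (complex_of_real \<zeta> - x) = \<bar>\<zeta> - x\<bar>" by (metis norm_of_real of_real_diff)
      also have "\<dots> \<le> real (n + 1) * X powr (- \<nu> - 1)" by (rule x(1))
      also have "\<dots> \<le> C * X powr (- \<nu> - 1)" by (intro mult_right_mono) (auto simp: C_def)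
      finally show ?thesis .
    qed
    ultimately show ?thesis using H(1,2) by blast
  qed
  moreover have "C \<ge> 1" by (simp add: C_def)
  ultimately show ?thesis by blast
qed

section \<open>Comparison of the exponents as suprema\<close>

text \<open>The standard basis, i.e. the monomials up to degree \<open>n\<close>, has values at
  \<zeta> bounded independently of \<open>X\<close>, while \<open>X powr (- \<nu>)\<close> tends to
  infinity. This supplies an admissible exponent above -1.\<close>

lemma eventually_good_system:
  assumes "\<nu> < 0"
  shows "\<forall>\<^sub>F X in at_top. good_system n (n + 1) \<zeta> \<nu> X"
proof -
  define Z where "Z = \<bar>\<zeta>\<bar> + 1"
  have "\<forall>\<^sub>F X::real in at_top. Z ^ n \<le> X powr (- \<nu>)" using assms by real_asymp
  moreover have "\<forall>\<^sub>F X::real in at_top. 1 \<le> X" by (rule eventually_ge_at_top)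
  ultimately show ?thesis
  proof eventually_elim
    case (elim X)
    define v where "v l k = (if l = k then 1 else 0 :: int)" for l k :: nat
    have "lin_indep_int n (n + 1) v"
      unfolding lin_indep_int_def by (auto simp: v_def if_distrib if_distribR cong: if_cong)
    moreover have "\<bar>real_of_int (v l 0) + (\<Sum>i=1..n. \<zeta> ^ i * real_of_int (v l i))\<bar> \<le> X powr (- \<nu>)"
      if "l \<le> n" for l
    proof -
      have "real_of_int (v l 0) + (\<Sum>i=1..n. \<zeta> ^ i * real_of_int (v l i)) = \<zeta> ^ l"
        using that by (cases "l = 0") (auto simp: v_def if_distrib if_distribR cong: if_cong)
      moreover have "\<bar>\<zeta> ^ l\<bar> \<le> Z ^ l"
        unfolding power_abs by (intro power_mono) (auto simp: Z_def)
      moreover have "Z ^ l \<le> Z ^ n" using that by (intro power_increasing) (auto simp: Z_def)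
      ultimately show ?thesis using elim by linarith
    qed
    ultimately show ?case
      using elim unfolding good_system_def
      by (intro exI[of _ v]) (auto simp: v_def)
  qed
qed

text \<open>Applied with \<open>b = -1\<close>: for exponents above \<open>-1\<close> the bound \<open>H(\<alpha>)\<^bsup>-\<nu>-1\<^esup>\<close> decreases in the
  height, so an upper bound on the height suffices.\<close>
lemma Sup_ereal_le_Sup_ereal:
  fixes A B :: "real set"
  assumes "a \<in> A" "b < a" "\<And>\<nu> \<nu>'. \<nu> \<in> A \<Longrightarrow> b < \<nu>' \<Longrightarrow> \<nu>' < \<nu> \<Longrightarrow> \<nu>' \<in> B"
  shows "Sup (ereal ` A) \<le> Sup (ereal ` B)"
proof -
  have main: "ereal \<nu> \<le> Sup (ereal ` B)" if \<nu>: "\<nu> \<in> A" "b < \<nu>" for \<nu>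
  proof (rule dense_le_bounded[of "ereal b"])
    fix w assume w: "ereal b < w" "w < ereal \<nu>"
    then obtain \<nu>' where [simp]: "w = ereal \<nu>'" by (cases w) auto
    with w assms(3)[OF \<nu>(1)] have "\<nu>' \<in> B" by simp
    thus "w \<le> Sup (ereal ` B)" by (auto intro: Sup_upper)
  qed (use \<nu> in simp)
  show ?thesis
  proof (rule Sup_least)
    fix y assume "y \<in> ereal ` A"
    then obtain \<nu> where \<nu>: "\<nu> \<in> A" "y = ereal \<nu>" by blast
    show "y \<le> Sup (ereal ` B)"
    proof (cases "b < \<nu>")
      \<comment> \<open>Elements of \<open>A\<close> that are not above \<open>b\<close> lie below
        \<open>a\<close>, which the case already proved covers.\<close>
      case False
      hence "y \<le> ereal a" using assms(2) \<nu> by simp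
      also have "\<dots> \<le> Sup (ereal ` B)" by (rule main[OF assms(1,2)])
      finally show ?thesis .
    qed (use main \<nu> in auto)
  qed
qed

theorem theorem1:
  fixes n :: nat and \<zeta> :: real
  assumes "n \<ge> 1"
    and "\<not> alg_deg_le n (complex_of_real \<zeta>)"
  shows "wstar n \<zeta> \<ge> w_lin n (n + 1) \<zeta> \<and> wstar_hat n \<zeta> \<ge> w_lin_hat n (n + 1) \<zeta>"
proof
  define good where "good \<nu> X = good_system n (n + 1) \<zeta> \<nu> X" for \<nu> X
  obtain C where C: "C \<ge> 1" and approx: "\<And>\<nu> X. X \<ge> 1 \<Longrightarrow> real (n + 1) * X powr (- \<nu>) \<le> X \<Longrightarrow> good \<nu> X \<Longrightarrow>
    (\<exists>\<alpha>. alg_deg_le n \<alpha> \<and> 1 \<le> Defs.height \<alpha> \<and> Defs.height \<alpha> \<le> C * X \<and>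
      cmod (complex_of_real \<zeta> - \<alpha>) \<le> C * X powr (- \<nu> - 1))"
    using good_system_imp_approximation[OF assms(1), of \<zeta>] unfolding good_def by blast
  have good_neg: "\<forall>\<^sub>F X in at_top. good (- 1 / 2) X"
    unfolding good_def by (rule eventually_good_system) simp
  \<comment> \<open>The gap between \<nu>' and \<nu> lets a power of \<open>X\<close> absorb the
    constant \<open>C\<close>. The bound by \<epsilon> holds for large \<open>X\<close> because
    \<nu> exceeds -1.\<close>
  have powr_large: "\<forall>\<^sub>F X in at_top. X \<ge> 1 \<and> real (n + 1) * X powr (- \<nu>) \<le> X \<and>
      C * X powr (- \<nu> - 1) < \<epsilon> \<and> C * X powr (- \<nu> - 1) \<le> (C * X) powr (- \<nu>' - 1)"
    if \<nu>: "- 1 < \<nu>'" "\<nu>' < \<nu>" and \<epsilon>: "\<epsilon> > 0" for \<nu> \<nu>' \<epsilon> :: real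
  proof -
    have "- \<nu> < 1" "- \<nu> - 1 < 0" "- \<nu> - 1 < - \<nu>' - 1" using \<nu> by auto
    have "\<forall>\<^sub>F X::real in at_top. X \<ge> 1" by (rule eventually_ge_at_top)
    moreover have "\<forall>\<^sub>F X::real in at_top. real (n + 1) * X powr (- \<nu>) \<le> X"
      using \<open>- \<nu> < 1\<close> by real_asymp
    moreover have "\<forall>\<^sub>F X::real in at_top. C * X powr (- \<nu> - 1) < \<epsilon>"
      using \<open>- \<nu> - 1 < 0\<close> \<epsilon> C by real_asymp
    moreover have "\<forall>\<^sub>F X::real in at_top. C * X powr (- \<nu> - 1) \<le> C powr (- \<nu>' - 1) * X powr (- \<nu>' - 1)"
      using \<open>- \<nu> - 1 < - \<nu>' - 1\<close> C by real_asymp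
    ultimately show ?thesis
      by eventually_elim (use C in \<open>simp add: powr_mult\<close>)
  qed
  show "w_lin n (n + 1) \<zeta> \<le> wstar n \<zeta>"
    unfolding w_lin_def wstar_def good_def[symmetric]
  proof (rule Sup_ereal_le_Sup_ereal[of "- 1 / 2" _ "- 1"]; (unfold mem_Collect_eq)?)
    show "\<exists>\<^sub>F X in at_top. good (- 1 / 2) X"
      using good_neg by (rule eventually_frequently[rotated]) simp
  next
    fix \<nu> \<nu>' :: real
    assume freq: "\<exists>\<^sub>F X in at_top. good \<nu> X" and \<nu>: "- 1 < \<nu>'" "\<nu>' < \<nu>"
    let ?S = "{\<alpha>. alg_deg_le n \<alpha> \<and> cmod (complex_of_real \<zeta> - \<alpha>) \<le> Defs.height \<alpha> powr (- \<nu>' - 1)}"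
    show "infinite ?S"
    proof
      assume fin: "finite ?S"
      \<comment> \<open>Inserting 1 gives a minimum even if the set is empty. It is positive because
        \<zeta>, not being algebraic of degree at most \<open>n\<close>, is not in the set. An
        approximation closer than \<epsilon> is then new, a contradiction.\<close>
      define \<epsilon> where "\<epsilon> = Min (insert 1 ((\<lambda>\<alpha>. cmod (complex_of_real \<zeta> - \<alpha>)) ` ?S))"
      have "\<epsilon> > 0" unfolding \<epsilon>_def using fin assms(2) by (subst Min_gr_iff) auto
      obtain X where X: "good \<nu> X" "X \<ge> 1" "real (n + 1) * X powr (- \<nu>) \<le> X"
        "C * X powr (- \<nu> - 1) < \<epsilon>" "C * X powr (- \<nu> - 1) \<le> (C * X) powr (- \<nu>' - 1)"
        using frequently_ex[OF frequently_eventually_frequently[OF freq powr_large[OF \<nu> \<open>\<epsilon> > 0\<close>]]] by blast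
      obtain \<alpha> where \<alpha>: "alg_deg_le n \<alpha>" "1 \<le> Defs.height \<alpha>" "Defs.height \<alpha> \<le> C * X"
        "cmod (complex_of_real \<zeta> - \<alpha>) \<le> C * X powr (- \<nu> - 1)"
        using approx[OF X(2,3,1)] by blast
      \<comment> \<open>The exponent \<open>- \<nu>' - 1\<close> is negative, so the upper bound on
        the height suffices.\<close>
      have "(C * X) powr (- \<nu>' - 1) \<le> Defs.height \<alpha> powr (- \<nu>' - 1)"
        using \<nu> \<alpha> by (intro powr_mono2') auto
      hence "\<alpha> \<in> ?S" using \<alpha> X by auto
      hence "\<epsilon> \<le> cmod (complex_of_real \<zeta> - \<alpha>)" unfolding \<epsilon>_def using fin by (intro Min_le) auto
      thus False using \<alpha>(4) X(4) by linarith
    qed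
  qed simp
  show "w_lin_hat n (n + 1) \<zeta> \<le> wstar_hat n \<zeta>"
    unfolding w_lin_hat_def wstar_hat_def good_def[symmetric]
  proof (rule Sup_ereal_le_Sup_ereal[of "- 1 / 2" _ "- 1"]; (unfold mem_Collect_eq)?)
    fix \<nu> \<nu>' :: real
    assume ev: "\<forall>\<^sub>F X in at_top. good \<nu> X" and \<nu>: "- 1 < \<nu>'" "\<nu>' < \<nu>"
    have one: "(0::real) < 1" by simp
    \<comment> \<open>Taking \<open>X = H / C\<close> turns the height bound \<open>C * X\<close>
      into \<open>H\<close>.\<close>
    have "filterlim (\<lambda>H. H / C) at_top at_top" using C by real_asymp
    from eventually_compose_filterlim[OF eventually_conj[OF ev powr_large[OF \<nu> one]] this]
    show "\<forall>\<^sub>F H in at_top. \<exists>\<alpha>. alg_deg_le n \<alpha> \<and> Defs.height \<alpha> \<le> H \<and>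
       cmod (complex_of_real \<zeta> - \<alpha>) \<le> Defs.height \<alpha> powr (-1) * H powr (- \<nu>')"
    proof eventually_elim
      case (elim H)
      have CH: "C * (H / C) = H" using C by simp
      obtain \<alpha> where \<alpha>: "alg_deg_le n \<alpha>" "1 \<le> Defs.height \<alpha>" "Defs.height \<alpha> \<le> H"
        "cmod (complex_of_real \<zeta> - \<alpha>) \<le> C * (H / C) powr (- \<nu> - 1)"
        using approx[of "H / C" \<nu>] elim unfolding CH by blast
      note \<alpha>(4)
      also have "C * (H / C) powr (- \<nu> - 1) \<le> H powr (- \<nu>' - 1)" using elim unfolding CH by blast
      also have "\<dots> = H powr (- 1) * H powr (- \<nu>')" using powr_add[of H "- 1" "- \<nu>'"] by (simp only: add.commute diff_conv_add_uminus)
      \<comment> \<open>One factor \<open>H powr (- 1)\<close> is traded for the larger inverse of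
        the height.\<close>
      also have "\<dots> \<le> Defs.height \<alpha> powr (-1) * H powr (- \<nu>')"
        using \<alpha> by (intro mult_right_mono powr_mono2') auto
      finally show ?case using \<alpha> by blast
    qed
  qed (use good_neg in simp_all)
qed

end
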